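(* Let $\mathbf Y=|\mathbf X|$ with $\mathbf X\sim ESN_p(\boldsymbol\mu,\boldsymbol\Sigma,\boldsymbol\lambda,\tau)$, let $\boldsymbol\kappa$ be a $p$-vector of nonnegative integers and $\boldsymbol\kappa^*=(\boldsymbol\kappa^\top,0)^\top$. For $\mathbf s\in S(p)=\{-1,1\}^p$ let $\boldsymbol\Lambda_s=\mathrm{Diag}(\mathbf s)$, $\boldsymbol\mu_s=\boldsymbol\Lambda_s\boldsymbol\mu$, $\boldsymbol\Sigma_s=\boldsymbol\Lambda_s\boldsymbol\Sigma\boldsymbol\Lambda_s$, $\boldsymbol\Delta_s=\boldsymbol\Lambda_s\boldsymbol\Delta$, $\boldsymbol\mu_s^*=(\boldsymbol\mu_s^\top,\tilde\tau)^\top$, $\boldsymbol\Omega_s=\begin{pmatrix}\boldsymbol\Sigma_s&-\boldsymbol\Delta_s\\-\boldsymbol\Delta_s^\top&1\end{pmatrix}$, and let $\boldsymbol\Omega_s^-$ be the block matrix $\boldsymbol\Omega_s$ with the signs of all its off-diagonal block elements changed, i.e. $\boldsymbol\Omega_s^-=\begin{pmatrix}\boldsymbol\Sigma_s&\boldsymbol\Delta_s\\\boldsymbol\Delta_s^\top&1\end{pmatrix}$. Then $$\mathbb E[\mathbf Y^{\boldsymbol\kappa}]=\xi^{-1}\sum_{\mathbf s\in S(p)}I^{p+1}_{\boldsymbol\kappa^*}(\boldsymbol\mu_s^*,\boldsymbol\Omega_s^-).$$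
   Context: Here $\boldsymbol\mu\in\mathbb R^p$, $\boldsymbol\Sigma$ is a $p\times p$ positive definite matrix with symmetric positive definite square root $\boldsymbol\Sigma^{1/2}$ (inverse $\boldsymbol\Sigma^{-1/2}$), $\boldsymbol\lambda\in\mathbb R^p$, $\tau\in\mathbb R$. $\phi_p(\cdot;\boldsymbol\mu,\boldsymbol\Sigma)$ is the $p$-variate normal density and $\Phi_1$ the standard univariate normal cdf. $\mathbf X\sim ESN_p(\boldsymbol\mu,\boldsymbol\Sigma,\boldsymbol\lambda,\tau)$ (extended skew-normal) means that $\mathbf X$ has density $$\xi^{-1}\phi_p(\mathbf x;\boldsymbol\mu,\boldsymbol\Sigma)\,\Phi_1\big(\tau+\boldsymbol\lambda^\top\boldsymbol\Sigma^{-1/2}(\mathbf x-\boldsymbol\mu)\big),\qquad \xi=\Phi_1(\tilde\tau),\quad\tilde\tau=\tau/(1+\boldsymbol\lambda^\top\boldsymbol\lambda)^{1/2}.$$ Set $\boldsymbol\Delta=\boldsymbol\Sigma^{1/2}\boldsymbol\lambda/(1+\boldsymbol\lambda^\top\boldsymbol\lambda)^{1/2}$. $|\mathbf X|=(|X_1|,\dots,|X_p|)^\top$; $\mathbf y^{\boldsymbol\kappa}=\prod_iy_i^{k_i}$; and $I^p_{\boldsymbol\kappa}(\boldsymbol\mu,\boldsymbol\Sigma)=\int_0^\infty\cdots\int_0^\infty\mathbf x^{\boldsymbol\kappa}\phi_p(\mathbf x;\boldsymbol\mu,\boldsymbol\Sigma)\,d\mathbf x$ (a $p$-fold integral). *)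

theory Defs
  imports "HOL-Probability.Probability"
begin

definition pos_def_matrix :: "real^'n^'n \<Rightarrow> bool" where
  "pos_def_matrix A \<longleftrightarrow> transpose A = A \<and> (\<forall>x. x \<noteq> 0 \<longrightarrow> x \<bullet> (A *v x) > 0)"

(* Meaningful only for positive definite A, where exactly one such B exists. *)
definition matrix_sqrt :: "real^'n^'n \<Rightarrow> real^'n^'n" where
  "matrix_sqrt A = (THE B. pos_def_matrix B \<and> B ** B = A)"

definition diag_matrix :: "real^'n \<Rightarrow> real^'n^'n" where
  "diag_matrix d = (\<chi> i j. if i = j then d $ i else 0)"

(* A vector of dimension p + 1 is indexed by 'n option, where p = CARD('n):
   "Some i" are the first p coordinates and "None" is the last one. *)
definition vec_snoc :: "'a^'n \<Rightarrow> 'a \<Rightarrow> 'a^('n option)" where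
  "vec_snoc v a = (\<chi> i. case i of Some j \<Rightarrow> v $ j | None \<Rightarrow> a)"

(* The matrix with rows (A, b) and (c^T, d). *)
definition bordered_matrix ::
  "'a^'n^'n \<Rightarrow> 'a^'n \<Rightarrow> 'a^'n \<Rightarrow> 'a \<Rightarrow> 'a^('n option)^('n option)" where
  "bordered_matrix A b c d = vec_snoc (\<chi> i. vec_snoc (A $ i) (b $ i)) (vec_snoc c d)"

definition flip_off_diagonal_blocks ::
  "real^(('n::finite) option)^('n option) \<Rightarrow> real^('n option)^('n option)" where
  "flip_off_diagonal_blocks A =
     (\<chi> i j. if (i = None) = (j = None) then A $ i $ j else - (A $ i $ j))"

definition vec_power :: "real^'n \<Rightarrow> nat^'n \<Rightarrow> real" where
  "vec_power y k = (\<Prod>i\<in>UNIV. (y $ i) ^ (k $ i))"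

definition mvn_density :: "real^'n \<Rightarrow> real^'n^'n \<Rightarrow> real^'n \<Rightarrow> real" where
  "mvn_density \<mu> \<Sigma> x =
     exp (- ((x - \<mu>) \<bullet> (matrix_inv \<Sigma> *v (x - \<mu>))) / 2) / sqrt ((2 * pi) ^ CARD('n) * det \<Sigma>)"

definition std_normal_cdf :: "real \<Rightarrow> real" where
  "std_normal_cdf = cdf std_normal_distribution"

definition esn_tau :: "real^'n \<Rightarrow> real \<Rightarrow> real" where
  "esn_tau l \<tau> = \<tau> / sqrt (1 + l \<bullet> l)"

definition esn_xi :: "real^'n \<Rightarrow> real \<Rightarrow> real" where
  "esn_xi l \<tau> = std_normal_cdf (esn_tau l \<tau>)"

definition esn_Delta :: "real^'n^'n \<Rightarrow> real^'n \<Rightarrow> real^'n" where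
  "esn_Delta \<Sigma> l = (1 / sqrt (1 + l \<bullet> l)) *\<^sub>R (matrix_sqrt \<Sigma> *v l)"

definition esn_density ::
  "real^'n \<Rightarrow> real^'n^'n \<Rightarrow> real^'n \<Rightarrow> real \<Rightarrow> real^'n \<Rightarrow> real" where
  "esn_density \<mu> \<Sigma> l \<tau> x =
     inverse (esn_xi l \<tau>) * mvn_density \<mu> \<Sigma> x *
     std_normal_cdf (\<tau> + l \<bullet> (matrix_inv (matrix_sqrt \<Sigma>) *v (x - \<mu>)))"

definition ESN_distributed ::
  "'a measure \<Rightarrow> ('a \<Rightarrow> real^'n) \<Rightarrow> real^'n \<Rightarrow> real^'n^'n \<Rightarrow> real^'n \<Rightarrow> real \<Rightarrow> bool" where
  "ESN_distributed M X \<mu> \<Sigma> l \<tau> \<longleftrightarrow> distributed M lborel X (\<lambda>x. ennreal (esn_density \<mu> \<Sigma> l \<tau> x))"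

(* The order on vectors is componentwise, so {0..} is the closed nonnegative orthant. *)
definition orthant_moment :: "nat^'n \<Rightarrow> real^'n \<Rightarrow> real^'n^'n \<Rightarrow> real" where
  "orthant_moment k \<mu> \<Sigma> = (LINT x:{0..}|lborel. vec_power x k * mvn_density \<mu> \<Sigma> x)"

definition sign_vectors :: "(real^'n) set" where
  "sign_vectors = {s. \<forall>i. s $ i \<in> {-1, 1}}"

end

theory Submission
  imports Defs
begin

text \<open>
  The extended skew-normal density is the marginal of a truncated normal density in one more
  dimension. Let \<open>k = 1 - \<Delta> \<bullet> \<Sigma>\<^sup>-\<^sup>1 \<Delta>\<close> be the Schur complement of \<open>\<Sigma>\<close> in the matrix with blocks
  \<open>\<Sigma>\<close>, \<open>\<Delta>\<close>, \<open>\<Delta>\<close>, \<open>1\<close>. Completing the square shows that under the normal density with this covariance and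
  mean \<open>(\<mu>, m)\<close> the last coordinate, given that the first ones equal \<open>x\<close>, is normal with mean
  \<open>m + \<Delta> \<bullet> \<Sigma>\<^sup>-\<^sup>1 (x - \<mu>)\<close> and variance \<open>k\<close> (\<open>mvn_density_bordered\<close>). Integrating it over the
  nonnegative half-line therefore multiplies the density of \<open>x\<close> by a value of the standard normal
  distribution function. For \<open>\<Delta> = \<Sigma>\<^sup>1\<^sup>/\<^sup>2 l / sqrt (1 + l \<bullet> l)\<close> one has \<open>k = 1 / (1 + l \<bullet> l)\<close>, and
  with \<open>m\<close> equal to \<open>\<tau> / sqrt (1 + l \<bullet> l)\<close> the argument of that function becomes
  \<open>\<tau> + l \<bullet> \<Sigma>\<^sup>-\<^sup>1\<^sup>/\<^sup>2 (x - \<mu>)\<close>, which is the skewing factor of the density of \<open>X\<close>.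

  The absolute value is handled by splitting the space into its orthants: up to the coordinate
  hyperplanes, which are null sets, each \<open>x\<close> is carried into the nonnegative orthant by exactly one
  diagonal sign matrix, and these matrices preserve Lebesgue measure (\<open>nn_integral_orthants\<close>).
  Reflecting a normal density by a sign matrix \<open>\<Lambda>\<close> gives the normal density with mean \<open>\<Lambda> \<mu>\<close> and
  covariance \<open>\<Lambda> \<Sigma> \<Lambda>\<close>. The quantities \<open>\<Delta> \<bullet> \<Sigma>\<^sup>-\<^sup>1 \<Delta>\<close> and \<open>\<Delta> \<bullet> \<Sigma>\<^sup>-\<^sup>1 (x - \<mu>)\<close> are invariant under
  the simultaneous reflection, so the marginalisation above applies on every orthant
  (\<open>nn_integral_orthant_reflected_esn\<close>) and the summands are the orthant moments of the claim.

  All integrands are nonnegative, so the computation is carried out with extended nonnegative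
  integrals. Real integrals are recovered from the finiteness of the absolute moments of a normal
  density (\<open>nn_integral_mvn_abs_moment_finite\<close>). The square root of \<open>\<Sigma>\<close> is specified by a definite
  description, which makes its existence and uniqueness part of the proof
  (\<open>matrix_sqrt_works\<close>).
\<close>

section \<open>Positive definite matrices and their square roots\<close>

lemma pos_def_matrixD:
  assumes "pos_def_matrix A"
  shows "transpose A = A" and "x \<noteq> 0 \<Longrightarrow> x \<bullet> (A *v x) > 0"
  using assms unfolding pos_def_matrix_def by auto

lemma pos_def_matrix_inner_swap:
  assumes "pos_def_matrix A"
  shows "(A *v x) \<bullet> y = x \<bullet> (A *v y)"
  using dot_lmul_matrix[of x A y] pos_def_matrixD(1)[OF assms]
  by (metis inner_commute dot_matrix_vector_mul transpose_matrix_vector)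

text \<open>
  The quadratic form attains a positive minimum on the compact unit sphere, and homogeneity extends
  this bound to all vectors.
\<close>
lemma pos_def_matrix_coercive:
  fixes A :: "real^'n^'n"
  assumes "pos_def_matrix A"
  obtains a where "a > 0" and "\<And>x. a * (norm x)\<^sup>2 \<le> x \<bullet> (A *v x)"
proof -
  have cont: "continuous_on (sphere 0 1) (\<lambda>x. x \<bullet> (A *v x))"
    by (intro continuous_intros linear_continuous_on linear_linear[THEN iffD2] matrix_vector_mul_linear)
  obtain u :: "real^'n" where u: "norm u = 1"
    using vector_choose_size[of 1] by auto
  then have "sphere (0::real^'n) 1 \<noteq> {}" by auto
  then obtain z where z: "z \<in> sphere 0 1" "\<And>y. y \<in> sphere 0 1 \<Longrightarrow> z \<bullet> (A *v z) \<le> y \<bullet> (A *v y)"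
    using continuous_attains_inf[OF compact_sphere _ cont] by blast
  define a where "a = z \<bullet> (A *v z)"
  have "z \<noteq> 0" using z(1) by auto
  then have "a > 0" unfolding a_def using pos_def_matrixD(2)[OF assms] by blast
  moreover have "a * (norm x)\<^sup>2 \<le> x \<bullet> (A *v x)" for x
  proof (cases "x = 0")
    case False
    have "a \<le> (x /\<^sub>R norm x) \<bullet> (A *v (x /\<^sub>R norm x))"
      unfolding a_def by (rule z(2)) (use False in auto)
    also have "\<dots> = (x \<bullet> (A *v x)) / (norm x)\<^sup>2"
      by (simp add: matrix_vector_mult_scaleR power2_eq_square divide_inverse)
    finally show ?thesis using False by (simp add: field_simps)
  qed auto
  ultimately show ?thesis using that by blast
qed

lemma minus_matrix_vector_mult: "(- A) *v x = - (A *v x)" for A :: "real^'n^'m"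
  by (metis matrix_vector_mult_0 matrix_vector_mult_diff_rdistrib diff_0)

text \<open>
  For \<open>D = B - C\<close> the equation \<open>B\<^sup>2 = C\<^sup>2\<close> gives \<open>B D + D C = 0\<close>. Multiplying by \<open>D\<close> and taking traces
  shows that the sum of the traces of \<open>D B D\<close> and \<open>D C D\<close> vanishes. The first trace is the sum over
  the columns \<open>v\<close> of \<open>D\<close> of \<open>v \<bullet> B v\<close>, and likewise for the second, so all columns are zero.
\<close>
lemma pos_def_matrix_sqrt_unique:
  fixes B C :: "real^'n^'n"
  assumes B: "pos_def_matrix B" and C: "pos_def_matrix C" and eq: "B ** B = C ** C"
  shows "B = C"
proof -
  define D where "D = B - C"
  have swapD: "(D *v x) \<bullet> y = x \<bullet> (D *v y)" for x y
    unfolding D_def by (simp add: matrix_vector_mult_diff_rdistrib inner_diff_left inner_diff_right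
        pos_def_matrix_inner_swap[OF B] pos_def_matrix_inner_swap[OF C])
  have "B *v (B *v x) = C *v (C *v x)" for x
    using eq by (simp add: matrix_vector_mul_assoc)
  then have comm: "B *v (D *v x) = - (D *v (C *v x))" for x
    unfolding D_def
    by (simp add: matrix_vector_mult_diff_rdistrib matrix_vector_mult_diff_distrib)
  have sandwich: "trace (D ** P ** D) = (\<Sum>i\<in>UNIV. (D *v axis i 1) \<bullet> (P *v (D *v axis i 1)))" for P
  proof -
    have "(D ** P ** D) $ i $ i = axis i 1 \<bullet> ((D ** P ** D) *v axis i 1)" for i
      by (simp add: inner_axis' matrix_vector_mult_basis column_def)
    then show ?thesis unfolding trace_def
      by (simp add: matrix_vector_mul_assoc[symmetric] swapD)
  qed
  \<comment> \<open>From \<open>B D = - D C\<close> the traces of \<open>D B D\<close> and \<open>D C D\<close> are opposite, but both are sums of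
    values of positive definite quadratic forms.\<close>
  have "D ** (B ** D) = - (D ** (D ** C))"
    unfolding matrix_eq by (simp add: matrix_vector_mul_assoc[symmetric] comm minus_matrix_vector_mult
        linear_neg[OF matrix_vector_mul_linear])
  then have "trace (D ** B ** D) = trace (- (D ** (D ** C)))"
    by (simp add: matrix_mul_assoc)
  also have "\<dots> = - trace (D ** (D ** C))"
    by (simp add: trace_def sum_negf)
  also have "trace (D ** (D ** C)) = trace (D ** C ** D)"
    using trace_mul_sym[of D "D ** C"] by (simp add: matrix_mul_assoc)
  finally have tr: "trace (D ** B ** D) + trace (D ** C ** D) = 0" by simp
  have nonneg: "0 \<le> x \<bullet> (P *v x)" if "pos_def_matrix P" for P and x :: "real^'n"
    using pos_def_matrixD(2)[OF that, of x] by (cases "x = 0") auto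
  have "(\<Sum>i\<in>UNIV. (D *v axis i 1) \<bullet> (B *v (D *v axis i 1))) = 0"
    using tr unfolding sandwich
    by (smt (verit) nonneg[OF B] nonneg[OF C] sum_nonneg)
  then have "(D *v axis i 1) \<bullet> (B *v (D *v axis i 1)) = 0" for i
    using sum_nonneg_eq_0_iff[of UNIV "\<lambda>i. (D *v axis i 1) \<bullet> (B *v (D *v axis i 1))"] nonneg[OF B]
    by auto
  then have "D *v axis i 1 = 0" for i
    using pos_def_matrixD(2)[OF B] by (metis less_irrefl)
  then have "column i D = 0" for i
    by (simp add: matrix_vector_mult_basis)
  then have "D = 0"
    by (simp add: vec_eq_iff column_def)
  then show ?thesis unfolding D_def by simp
qed

text \<open>
  After scaling, \<open>A / c = 1 - T\<close> with \<open>T\<close> symmetric of operator norm less than one. A solution of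
  \<open>X = (T + X\<^sup>2) / 2\<close> satisfies \<open>(1 - X)\<^sup>2 = 1 - T\<close>, and Banach's fixed-point theorem provides a
  symmetric one of norm less than one, for which \<open>1 - X\<close> is positive definite. This avoids
  the spectral theorem. The operator norm is essential: the Euclidean norm of the entries of
  \<open>T\<close> need not be below one, so the iteration runs in the space of bounded linear maps.
\<close>
lemma pos_def_matrix_sqrt_exists:
  fixes A :: "real^'n^'n"
  assumes A: "pos_def_matrix A"
  obtains B where "pos_def_matrix B" and "B ** B = A"
proof -
  obtain a where a: "a > 0" "\<And>x. a * (norm x)\<^sup>2 \<le> x \<bullet> (A *v x)"
    using pos_def_matrix_coercive[OF A] by blast
  obtain m where m: "m \<ge> a" "\<And>x. norm (A *v x) \<le> m * norm x"
  proof -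
    obtain k where k: "\<And>x. norm (A *v x) \<le> norm x * k"
      using bounded_linear.bounded[OF matrix_vector_mul_bounded_linear[of A]] by blast
    have "norm (A *v x) \<le> max a k * norm x" for x
      using k[of x] mult_left_mono[of k "max a k" "norm x"] by (simp add: mult.commute)
    then show ?thesis using that[of "max a k"] by auto
  qed
  \<comment> \<open>With this scaling the map \<open>x - A x / c\<close> has operator norm at most
    \<open>sqrt (1 - (a / m)\<^sup>2) < 1\<close>, by expanding the square of its norm.\<close>
  define c where "c = m\<^sup>2 / a"
  have m0: "m > 0" using m(1) a(1) by simp
  have c: "c > 0" unfolding c_def using a m0 by simp
  define b where "b = sqrt (1 - (a / m)\<^sup>2)"
  have am: "(a / m)\<^sup>2 > 0" "(a / m)\<^sup>2 \<le> 1"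
    using a m m0 by (auto simp: power_le_one)
  have b: "0 \<le> b" "b < 1" unfolding b_def using am by auto
  define T :: "(real^'n) \<Rightarrow>\<^sub>L (real^'n)" where "T = Blinfun (\<lambda>x. x - (1 / c) *\<^sub>R (A *v x))"
  have T: "blinfun_apply T x = x - (1 / c) *\<^sub>R (A *v x)" for x
    unfolding T_def
    by (subst bounded_linear_Blinfun_apply)
       (auto intro!: bounded_linear_intros matrix_vector_mul_bounded_linear)
  have "norm T \<le> b"
  proof (rule norm_blinfun_bound[OF b(1)])
    fix x
    have "(norm (T x))\<^sup>2 = (norm x)\<^sup>2 - 2 / c * (x \<bullet> (A *v x)) + (norm (A *v x))\<^sup>2 / c\<^sup>2"
      unfolding T power2_norm_eq_inner
      by (simp add: inner_diff_left inner_diff_right inner_commute power2_eq_square)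
    also have "\<dots> \<le> (norm x)\<^sup>2 - 2 / c * (a * (norm x)\<^sup>2) + (m * norm x)\<^sup>2 / c\<^sup>2"
      using a(2)[of x] m(2)[of x] c
      by (intro add_mono diff_left_mono divide_right_mono mult_left_mono power_mono) auto
    also have "\<dots> = (1 - (a / m)\<^sup>2) * (norm x)\<^sup>2"
      using a m0 unfolding c_def by (simp add: field_simps power2_eq_square)
    also have "\<dots> = (b * norm x)\<^sup>2"
      using am unfolding b_def by (simp add: power_mult_distrib)
    finally show "norm (T x) \<le> b * norm x"
      by (rule power2_le_imp_le) (use b in auto)
  qed
  \<comment> \<open>The radius is the smaller solution of \<open>(b + r\<^sup>2) / 2 = r\<close>: the iteration maps the ball of this
    radius into itself and contracts it by the factor \<open>r < 1\<close>.\<close>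
  define r where "r = 1 - sqrt (1 - b)"
  have r: "0 \<le> r" "r < 1" unfolding r_def using b by auto
  have r_fix: "(b + r * r) / 2 = r"
  proof -
    have "(1 - r)\<^sup>2 = 1 - b" unfolding r_def using b by simp
    then show ?thesis by (simp add: power2_eq_square algebra_simps)
  qed
  define K where "K = {X :: (real^'n) \<Rightarrow>\<^sub>L (real^'n). norm X \<le> r \<and> (\<forall>x y. blinfun_apply X x \<bullet> y = x \<bullet> blinfun_apply X y)}"
  define F where "F X = (1 / 2) *\<^sub>R (T + (X o\<^sub>L X))" for X
  have "closed K"
    unfolding K_def
    by (intro closed_Collect_conj closed_Collect_all closed_Collect_le closed_Collect_eq continuous_intros)
  note complete_eq_closed[THEN iffD2, OF this]
  moreover have "K \<noteq> {}" using r unfolding K_def by (auto intro!: exI[of _ 0])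
  moreover have "F ` K \<subseteq> K"
  proof (rule image_subsetI)
    fix X assume X: "X \<in> K"
    have "norm (T + (X o\<^sub>L X)) \<le> b + r * r"
      using \<open>norm T \<le> b\<close> X norm_blinfun_compose[of X X] mult_mono[of "norm X" r "norm X" r] r
      unfolding K_def by (auto intro!: norm_triangle_le)
    then have "norm (F X) \<le> r"
      unfolding F_def using r_fix by simp
    moreover have "F X x \<bullet> y = x \<bullet> F X y" for x y
      using X unfolding K_def F_def T
      by (simp add: blinfun.bilinear_simps T inner_diff_left inner_diff_right inner_add_left inner_add_right
          pos_def_matrix_inner_swap[OF A])
    ultimately show "F X \<in> K" unfolding K_def by simp
  qed
  moreover have "dist (F X) (F Y) \<le> r * dist X Y" if "X \<in> K" "Y \<in> K" for X Y
  proof -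
    have "F X - F Y = (1 / 2) *\<^sub>R ((X o\<^sub>L (X - Y)) + ((X - Y) o\<^sub>L Y))"
      unfolding F_def by (intro blinfun_eqI) (simp add: blinfun.bilinear_simps algebra_simps)
    also have "norm \<dots> \<le> (1 / 2) * (r * norm (X - Y) + norm (X - Y) * r)"
      using norm_blinfun_compose[of X "X - Y"] norm_blinfun_compose[of "X - Y" Y] that
        mult_right_mono[of "norm X" r "norm (X - Y)"] mult_left_mono[of "norm Y" r "norm (X - Y)"]
      unfolding K_def by (auto intro!: norm_triangle_le simp: mult.commute)
    finally show ?thesis by (simp add: dist_norm)
  qed
  ultimately obtain X where X: "X \<in> K" "F X = X"
    using Banach_fix[of K r F] r by blast
  define G where "G x = sqrt c *\<^sub>R (x - X x)" for x
  have "linear G" unfolding G_def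
    by (intro linearI) (simp_all add: blinfun.bilinear_simps algebra_simps)
  define B where "B = matrix G"
  have B: "B *v x = G x" for x
    unfolding B_def using \<open>linear G\<close> by (simp add: matrix_vector_mul)
  have "T x + X (X x) = 2 *\<^sub>R X x" for x
  proof -
    have "2 *\<^sub>R X x = 2 *\<^sub>R F X x" using X by simp
    then show ?thesis unfolding F_def by (simp add: blinfun.bilinear_simps)
  qed
  then have XX: "X (X x) = 2 *\<^sub>R X x - T x" for x
    by (metis add_diff_cancel_left')
  have "(B ** B) *v x = A *v x" for x
  proof -
    have "(B ** B) *v x = c *\<^sub>R (x - 2 *\<^sub>R X x + X (X x))"
      using c by (simp add: matrix_vector_mul_assoc[symmetric] B G_def blinfun.bilinear_simps
          scaleR_2 algebra_simps flip: real_sqrt_mult)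
    then show ?thesis unfolding XX T using c by (simp add: algebra_simps)
  qed
  then have "B ** B = A" by (simp add: matrix_eq)
  moreover have "pos_def_matrix B"
    unfolding pos_def_matrix_def
  proof (intro conjI allI impI)
    have "(B *v x) \<bullet> y = x \<bullet> (B *v y)" for x y
      using X(1) unfolding K_def by (simp add: B G_def inner_diff_left inner_diff_right)
    then have "(transpose B *v y) \<bullet> x = (B *v y) \<bullet> x" for x y
      by (metis dot_lmul_matrix inner_commute transpose_matrix_vector)
    then have "transpose B *v y = B *v y" for y
      by (metis vector_eq_rdot)
    then show "transpose B = B" by (simp add: matrix_eq)
  next
    fix x :: "real^'n" assume x: "x \<noteq> 0"
    have "x \<bullet> X x \<le> norm x * (r * norm x)"
      using norm_cauchy_schwarz[of x "X x"] norm_blinfun[of X x] X(1)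
        mult_right_mono[of "norm X" r "norm x"] mult_left_mono[of "norm (X x)" "r * norm x" "norm x"]
      unfolding K_def by force
    also have "\<dots> < (norm x)\<^sup>2"
      using r x by (simp add: power2_eq_square)
    finally show "x \<bullet> (B *v x) > 0"
      using c by (simp add: B G_def inner_diff_right power2_norm_eq_inner)
  qed
  ultimately show ?thesis using that by blast
qed

lemma matrix_sqrt_works:
  assumes "pos_def_matrix A"
  shows "pos_def_matrix (matrix_sqrt A)" and "matrix_sqrt A ** matrix_sqrt A = A"
proof -
  have "\<exists>!B. pos_def_matrix B \<and> B ** B = A"
    using pos_def_matrix_sqrt_exists[OF assms] pos_def_matrix_sqrt_unique by metis
  then have "pos_def_matrix (matrix_sqrt A) \<and> matrix_sqrt A ** matrix_sqrt A = A"
    unfolding matrix_sqrt_def by (rule theI')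
  then show "pos_def_matrix (matrix_sqrt A)" and "matrix_sqrt A ** matrix_sqrt A = A" by auto
qed

lemma matrix_inv_right: "A ** matrix_inv A = mat 1"
  and matrix_inv_left: "matrix_inv A ** A = mat 1"
  if "invertible A" for A :: "real^'n^'n"
  using someI_ex[OF that[unfolded invertible_def]] unfolding matrix_inv_def by auto

lemma matrix_inv_vec_eqI:
  fixes A :: "real^'n^'n"
  assumes "invertible A" "A *v y = x"
  shows "matrix_inv A *v x = y"
  using assms by (metis matrix_inv_left matrix_vector_mul_assoc matrix_vector_mul_lid)

lemma pos_def_matrix_invertible:
  fixes A :: "real^'n^'n"
  assumes "pos_def_matrix A"
  shows "invertible A"
proof -
  have "x = 0" if "A *v x = 0" for x
    using pos_def_matrixD(2)[OF assms, of x] that by force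
  then show ?thesis
    using matrix_left_invertible_ker[of A] by (metis invertible_def matrix_left_right_inverse)
qed

text \<open>
  The determinant is the square of the determinant of the matrix square root, and it does not vanish
  because the matrix is invertible.
\<close>
lemma pos_def_matrix_det_pos:
  fixes A :: "real^'n^'n"
  assumes "pos_def_matrix A"
  shows "det A > 0"
proof -
  have "det A = (det (matrix_sqrt A))\<^sup>2"
    by (metis assms det_mul matrix_sqrt_works(2) power2_eq_square)
  then show ?thesis
    using pos_def_matrix_invertible[OF assms] by (simp add: invertible_det_nz)
qed

lemma pos_def_matrix_inv:
  fixes A :: "real^'n^'n"
  assumes A: "pos_def_matrix A"
  shows "pos_def_matrix (matrix_inv A)"
  unfolding pos_def_matrix_def
proof (intro conjI allI impI)
  note inv = pos_def_matrix_invertible[OF A]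
  have "transpose (matrix_inv A) ** A = mat 1"
    by (metis matrix_inv_right[OF inv] matrix_transpose_mul pos_def_matrixD(1)[OF A] transpose_mat)
  then show "transpose (matrix_inv A) = matrix_inv A"
    by (metis matrix_inv_right[OF inv] matrix_mul_assoc matrix_mul_lid matrix_mul_rid)
  fix x :: "real^'n" assume x: "x \<noteq> 0"
  define y where "y = matrix_inv A *v x"
  have Ay: "A *v y = x"
    unfolding y_def by (simp add: matrix_vector_mul_assoc matrix_inv_right[OF inv])
  then have "y \<noteq> 0" using x by auto
  then have "0 < y \<bullet> (A *v y)" using pos_def_matrixD(2)[OF A] by blast
  then show "0 < x \<bullet> (matrix_inv A *v x)"
    unfolding Ay by (simp add: y_def inner_commute)
qed

section \<open>Bordered matrices\<close>

lemma vec_snoc_simps [simp]: "vec_snoc v a $ Some i = v $ i" "vec_snoc v a $ None = a"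
  unfolding vec_snoc_def by simp_all

lemma bordered_matrix_simps [simp]:
  "bordered_matrix A b c d $ Some i $ Some j = A $ i $ j"
  "bordered_matrix A b c d $ Some i $ None = b $ i"
  "bordered_matrix A b c d $ None $ Some j = c $ j"
  "bordered_matrix A b c d $ None $ None = d"
  unfolding bordered_matrix_def by simp_all

lemma sum_UNIV_option: "(\<Sum>i\<in>(UNIV::'n::finite option set). f i) = f None + (\<Sum>i\<in>UNIV. f (Some i))"
  by (simp add: UNIV_option_conv sum.reindex)

lemma prod_UNIV_option: "(\<Prod>i\<in>(UNIV::'n::finite option set). f i) = f None * (\<Prod>i\<in>UNIV. f (Some i))"
  by (simp add: UNIV_option_conv prod.reindex)

lemma vec_option_eq_iff:
  "x = (y :: 'a^('n::finite option)) \<longleftrightarrow> x $ None = y $ None \<and> (\<forall>i. x $ Some i = y $ Some i)"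
  unfolding vec_eq_iff using option.exhaust by metis

lemma inner_vec_snoc: "vec_snoc x a \<bullet> vec_snoc y b = x \<bullet> y + a * (b::real)"
  for x y :: "real^'n"
  by (simp add: inner_vec_def sum_UNIV_option)

lemma bordered_matrix_mult_vec_snoc:
  "bordered_matrix A b c d *v vec_snoc x (t::real) = vec_snoc (A *v x + t *\<^sub>R b) (c \<bullet> x + d * t)"
  for x :: "real^'n"
  unfolding vec_option_eq_iff
  by (simp add: matrix_vector_mult_def sum_UNIV_option inner_vec_def)

text \<open>
  In the expansion over permutations only those fixing the last index contribute. They correspond
  to the permutations of the other indices, with the same signs.
\<close>
lemma det_bordered_matrix_zero_row:
  fixes A :: "real^'n^'n"
  shows "det (bordered_matrix A b 0 d) = d * det A"
proof -
  let ?M = "bordered_matrix A b 0 d"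
  let ?g = "\<lambda>p. of_int (sign p) * (\<Prod>i\<in>UNIV. ?M $ i $ p i)"
  let ?P = "{p :: 'n option \<Rightarrow> 'n option. p permutes UNIV}"
  let ?Q = "{p :: 'n option \<Rightarrow> 'n option. p permutes range Some}"
  have rng: "range Some = UNIV - {None :: 'n option}"
    using notin_range_Some by auto
  have bij: "bij_betw (Some :: 'n \<Rightarrow> 'n option) UNIV (range Some)"
    by (simp add: bij_betw_def)
  have "det ?M = sum ?g ?P" unfolding det_def ..
  also have "\<dots> = sum ?g ?Q"
  proof (rule sum.mono_neutral_right)
    show "?Q \<subseteq> ?P" by (auto intro: permutes_subset)
    \<comment> \<open>A permutation that moves the last index picks a zero of the last row.\<close>
    show "\<forall>p \<in> ?P - ?Q. ?g p = 0"
    proof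
      fix p assume p: "p \<in> ?P - ?Q"
      have "p None \<noteq> None"
      proof
        assume "p None = None"
        then have "p permutes range Some"
          unfolding rng using p by (auto simp: permutes_def)
        then show False using p by simp
      qed
      then have "?M $ None $ p None = 0" by (cases "p None") auto
      then show "?g p = 0" by (simp add: prod_UNIV_option)
    qed
  qed (simp add: finite_permutations)
  also have "\<dots> = (\<Sum>q | q permutes (UNIV :: 'n set). ?g (map_permutation UNIV Some q))"
    by (rule sum.reindex_bij_betw[symmetric])
       (use bij_betw_permutations[OF bij] in \<open>simp add: map_permutation_def[abs_def] restrict_id_def[abs_def] o_def\<close>)
  also have "\<dots> = (\<Sum>q | q permutes (UNIV :: 'n set). d * (of_int (sign q) * (\<Prod>i\<in>UNIV. A $ i $ q i)))"
  proof (rule sum.cong[OF refl])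
    fix q :: "'n \<Rightarrow> 'n" assume "q \<in> {q. q permutes UNIV}"
    then have q: "q permutes UNIV" by simp
    let ?p = "map_permutation UNIV Some q"
    have "?p (Some i) = Some (q i)" for i
      by (simp add: map_permutation_def restrict_id_def)
    moreover have "?p None = None"
      by (simp add: map_permutation_def restrict_id_def)
    moreover have "sign ?p = sign q"
      by (rule sign_map_permutation) (use q in auto)
    ultimately show "?g ?p = d * (of_int (sign q) * (\<Prod>i\<in>UNIV. A $ i $ q i))"
      by (simp add: prod_UNIV_option)
  qed
  also have "\<dots> = d * det A"
    unfolding det_def by (simp add: sum_distrib_left)
  finally show ?thesis .
qed

lemma det_bordered_matrix_zero_column:
  "det (bordered_matrix A (0::real^'n) c d) = d * det A"
proof -
  have "bordered_matrix A 0 c d = transpose (bordered_matrix (transpose A) c 0 d)"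
    unfolding vec_option_eq_iff by (simp add: transpose_def)
  then show ?thesis by (simp add: det_transpose det_bordered_matrix_zero_row)
qed

text \<open>
  The Schur complement formula. It follows from the factorisation of the bordered matrix into a
  block lower triangular and a block upper triangular one, the latter with unit diagonal blocks.
\<close>
lemma det_bordered_matrix:
  fixes A :: "real^'n^'n"
  assumes A: "invertible A" 
  shows "det (bordered_matrix A b c d) = (d - c \<bullet> (matrix_inv A *v b)) * det A"
proof -
  let ?v = "matrix_inv A *v b"
  have "A *v ?v = b"
    by (simp add: matrix_vector_mul_assoc matrix_inv_right[OF A])
  then have Av: "(\<Sum>k\<in>UNIV. A $ i $ k * ?v $ k) = b $ i" for i
    by (metis (mono_tags) matrix_vector_mult_def vec_lambda_beta)
  have "bordered_matrix A b c d = bordered_matrix A 0 c (d - c \<bullet> ?v) ** bordered_matrix (mat 1) ?v 0 1"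
    by (auto simp: Av vec_option_eq_iff matrix_matrix_mult_def sum_UNIV_option
      inner_vec_def mat_def if_distrib cong: if_cong)
  then show ?thesis
    by (simp add: det_mul det_bordered_matrix_zero_column det_bordered_matrix_zero_row det_I)
qed

text \<open>
  Here \<open>w\<close> is the last unknown of the linear system, found by block elimination; the other unknowns
  follow by back substitution.
\<close>
lemma matrix_inv_bordered_matrix_mult:
  fixes A :: "real^'n^'n"
  assumes A: "invertible A" and k: "k = d - c \<bullet> (matrix_inv A *v b)" "k \<noteq> 0"
  shows "matrix_inv (bordered_matrix A b c d) *v vec_snoc x t =
    (let w = (t - c \<bullet> (matrix_inv A *v x)) / k
     in vec_snoc (matrix_inv A *v x - w *\<^sub>R (matrix_inv A *v b)) w)"
proof -
  define w where "w = (t - c \<bullet> (matrix_inv A *v x)) / k"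
  have "invertible (bordered_matrix A b c d)"
    using A k by (simp add: invertible_det_nz det_bordered_matrix)
  moreover have "bordered_matrix A b c d *v
      vec_snoc (matrix_inv A *v x - w *\<^sub>R (matrix_inv A *v b)) w = vec_snoc x t"
  proof -
    have "c \<bullet> (matrix_inv A *v x) - w * (c \<bullet> (matrix_inv A *v b)) + d * w = t"
    proof -
      have "w * k = t - c \<bullet> (matrix_inv A *v x)" unfolding w_def using k(2) by simp
      then show ?thesis unfolding k(1) by (simp add: algebra_simps)
    qed
    then show ?thesis
      by (simp add: bordered_matrix_mult_vec_snoc matrix_vector_mult_diff_distrib matrix_vector_mult_scaleR
          matrix_vector_mul_assoc matrix_inv_right[OF A] inner_diff_right)
  qed
  ultimately show ?thesis
    unfolding Let_def w_def[symmetric] by (rule matrix_inv_vec_eqI)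
qed

text \<open>
  Completing the square in the last coordinate: this is what separates the joint normal density
  into a marginal and a conditional factor.
\<close>
lemma bordered_quadratic_form:
  fixes A :: "real^'n^'n"
  assumes A: "pos_def_matrix A" and k: "k = d - b \<bullet> (matrix_inv A *v b)" "k \<noteq> 0"
  shows "vec_snoc x t \<bullet> (matrix_inv (bordered_matrix A b b d) *v vec_snoc x t) =
    x \<bullet> (matrix_inv A *v x) + (t - b \<bullet> (matrix_inv A *v x))\<^sup>2 / k"
proof -
  have swap: "x \<bullet> (matrix_inv A *v b) = b \<bullet> (matrix_inv A *v x)"
    using pos_def_matrix_inner_swap[OF pos_def_matrix_inv[OF A]] by (metis inner_commute)
  show ?thesis
    unfolding matrix_inv_bordered_matrix_mult[OF pos_def_matrix_invertible[OF A] k] Let_def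
      inner_vec_snoc inner_diff_right inner_scaleR_right swap
    by (simp add: power2_eq_square algebra_simps flip: add_divide_distrib diff_divide_distrib)
qed

section \<open>Reflections by sign matrices\<close>

lemma diag_matrix_mult_vec: "(diag_matrix s *v x) $ i = s $ i * x $ i"
  for s :: "real^'n"
  by (simp add: diag_matrix_def matrix_vector_mult_def if_distribR if_distrib[of "\<lambda>c. c * x" for x] cong: if_cong)

lemma sign_vectors_square: "s \<in> sign_vectors \<Longrightarrow> s $ i * s $ i = 1"
  unfolding sign_vectors_def by (auto dest: spec[of _ i])

lemma diag_sign_involution: "s \<in> sign_vectors \<Longrightarrow> diag_matrix s *v (diag_matrix s *v x) = x"
  by (simp add: vec_eq_iff diag_matrix_mult_vec sign_vectors_square flip: mult.assoc)

lemma diag_matrix_swap: "(diag_matrix s *v x) \<bullet> y = x \<bullet> (diag_matrix s *v y)"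
  by (simp add: inner_vec_def diag_matrix_mult_vec algebra_simps)

lemma diag_sign_isometry: "s \<in> sign_vectors \<Longrightarrow> (diag_matrix s *v x) \<bullet> (diag_matrix s *v y) = x \<bullet> y"
  by (metis diag_matrix_swap diag_sign_involution)

lemma diag_sign_square: "s \<in> sign_vectors \<Longrightarrow> diag_matrix s ** diag_matrix s = mat 1"
  by (simp add: matrix_eq diag_sign_involution flip: matrix_vector_mul_assoc)

lemma reflected_mult_vec:
  "(diag_matrix s ** A ** diag_matrix s) *v x = diag_matrix s *v (A *v (diag_matrix s *v x))"
  for A :: "real^'n^'n"
  by (simp add: matrix_vector_mul_assoc matrix_mul_assoc)

lemma pos_def_matrix_reflected:
  fixes A :: "real^'n^'n"
  assumes A: "pos_def_matrix A" and s: "s \<in> sign_vectors"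
  shows "pos_def_matrix (diag_matrix s ** A ** diag_matrix s)"
  unfolding pos_def_matrix_def
proof (intro conjI allI impI)
  have "transpose (diag_matrix s) = diag_matrix s"
    by (auto simp: diag_matrix_def transpose_def vec_eq_iff)
  then show "transpose (diag_matrix s ** A ** diag_matrix s) = diag_matrix s ** A ** diag_matrix s"
    using pos_def_matrixD(1)[OF A] by (simp add: matrix_transpose_mul matrix_mul_assoc)
  fix x :: "real^'n" assume "x \<noteq> 0"
  then have "diag_matrix s *v x \<noteq> 0" using diag_sign_involution[OF s, of x] by auto
  then show "0 < x \<bullet> (diag_matrix s ** A ** diag_matrix s *v x)"
    unfolding reflected_mult_vec diag_matrix_swap[symmetric] by (rule pos_def_matrixD(2)[OF A])
qed

lemma matrix_inv_reflected:
  fixes A :: "real^'n^'n"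
  assumes A: "pos_def_matrix A" and s: "s \<in> sign_vectors"
  shows "matrix_inv (diag_matrix s ** A ** diag_matrix s) *v (diag_matrix s *v x) =
    diag_matrix s *v (matrix_inv A *v x)"
proof (rule matrix_inv_vec_eqI)
  show "invertible (diag_matrix s ** A ** diag_matrix s)"
    by (rule pos_def_matrix_invertible[OF pos_def_matrix_reflected[OF A s]])
  show "diag_matrix s ** A ** diag_matrix s *v (diag_matrix s *v (matrix_inv A *v x)) = diag_matrix s *v x"
    unfolding reflected_mult_vec diag_sign_involution[OF s]
    by (simp add: matrix_vector_mul_assoc[of A] matrix_inv_right[OF pos_def_matrix_invertible[OF A]])
qed

section \<open>Normal densities\<close>

lemma mvn_density_nonneg: "pos_def_matrix A \<Longrightarrow> 0 \<le> mvn_density \<mu> A x"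
  unfolding mvn_density_def using pos_def_matrix_det_pos[of A] by simp

text \<open>
  A sign matrix is its own inverse and an isometry, so it leaves both the quadratic form and the
  determinant unchanged.
\<close>
lemma mvn_density_reflected:
  fixes A :: "real^'n^'n"
  assumes A: "pos_def_matrix A" and s: "s \<in> sign_vectors"
  shows "mvn_density (diag_matrix s *v \<mu>) (diag_matrix s ** A ** diag_matrix s) (diag_matrix s *v x) =
    mvn_density \<mu> A x"
proof -
  have "det (diag_matrix s) * det (diag_matrix s) = 1"
    by (metis det_I det_mul diag_sign_square[OF s])
  then have "det (diag_matrix s ** A ** diag_matrix s) = det A"
    by (simp add: det_mul)
  then show ?thesis
    unfolding mvn_density_def
    by (simp add: matrix_inv_reflected[OF A s] diag_sign_isometry[OF s] flip: matrix_vector_mult_diff_distrib)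
qed

lemma ennreal_std_normal_cdf:
  "ennreal (std_normal_cdf z) = (\<integral>\<^sup>+ u. ennreal (std_normal_density u) * indicator {..z} u \<partial>lborel)"
proof -
  interpret prob_space std_normal_distribution by (rule prob_space_normal_density) simp
  show ?thesis
    unfolding std_normal_cdf_def cdf_def emeasure_eq_measure[symmetric]
    by (subst emeasure_density) auto
qed

lemma std_normal_cdf_nonneg: "0 \<le> std_normal_cdf z"
  and std_normal_cdf_le_1: "std_normal_cdf z \<le> 1"
proof -
  interpret prob_space std_normal_distribution by (rule prob_space_normal_density) simp
  show "0 \<le> std_normal_cdf z" "std_normal_cdf z \<le> 1"
    unfolding std_normal_cdf_def cdf_def by simp_all
qed

lemma borel_measurable_std_normal_cdf [measurable]: "std_normal_cdf \<in> borel_measurable borel"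
proof (rule borel_measurable_mono)
  interpret prob_space std_normal_distribution by (rule prob_space_normal_density) simp
  show "mono std_normal_cdf"
    unfolding std_normal_cdf_def cdf_def mono_def by (auto intro!: finite_measure_mono)
qed

lemma nn_integral_normal_density_nonneg_halfline:
  assumes \<sigma>: "\<sigma> > 0"
  shows "(\<integral>\<^sup>+ t. ennreal (normal_density m \<sigma> t) * indicator {0..} t \<partial>lborel) =
    ennreal (std_normal_cdf (m / \<sigma>))"
proof -
  \<comment> \<open>The substitution \<open>t = m - \<sigma> u\<close> reverses the orientation, which turns the half-line
    \<open>t \<ge> 0\<close> into the lower tail \<open>u \<le> m / \<sigma>\<close>.\<close>
  have "(\<integral>\<^sup>+ t. ennreal (normal_density m \<sigma> t) * indicator {0..} t \<partial>lborel) =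
      ennreal \<bar>- \<sigma>\<bar> * (\<integral>\<^sup>+ u. ennreal (normal_density m \<sigma> (m + - \<sigma> * u)) * indicator {0..} (m + - \<sigma> * u) \<partial>lborel)"
    by (rule nn_integral_real_affine) (use \<sigma> in auto)
  also have "\<dots> = (\<integral>\<^sup>+ u. ennreal \<sigma> * (ennreal (normal_density m \<sigma> (m + - \<sigma> * u)) * indicator {0..} (m + - \<sigma> * u)) \<partial>lborel)"
    using \<sigma> by (simp add: nn_integral_cmult)
  also have "\<dots> = (\<integral>\<^sup>+ u. ennreal (std_normal_density u) * indicator {..m / \<sigma>} u \<partial>lborel)"
  proof (rule nn_integral_cong)
    fix u :: real
    have "\<sigma> * normal_density m \<sigma> (m + - \<sigma> * u) = std_normal_density u"
      using \<sigma> unfolding normal_density_def by (simp add: real_sqrt_mult power_mult_distrib)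
    moreover have "(indicator {0..} (m + - \<sigma> * u) :: ennreal) = indicator {..m / \<sigma>} u"
      using \<sigma> by (auto simp: indicator_def field_simps)
    ultimately show "ennreal \<sigma> * (ennreal (normal_density m \<sigma> (m + - \<sigma> * u)) * indicator {0..} (m + - \<sigma> * u)) =
        ennreal (std_normal_density u) * indicator {..m / \<sigma>} u"
      using \<sigma> by (simp flip: mult.assoc ennreal_mult)
  qed
  finally show ?thesis by (simp add: ennreal_std_normal_cdf)
qed

text \<open>
  The joint density is the marginal density of the first coordinates times the conditional density
  of the last one, whose variance is the Schur complement \<open>k\<close>.
\<close>
lemma mvn_density_bordered:
  fixes A :: "real^'n^'n"
  assumes A: "pos_def_matrix A" and k: "k = d - b \<bullet> (matrix_inv A *v b)" "k > 0"
  shows "mvn_density (vec_snoc \<mu> m) (bordered_matrix A b b d) (vec_snoc x t) =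
    mvn_density \<mu> A x * normal_density (m + b \<bullet> (matrix_inv A *v (x - \<mu>))) (sqrt k) t"
proof -
  have diff: "vec_snoc x t - vec_snoc \<mu> m = vec_snoc (x - \<mu>) (t - m)"
    by (simp add: vec_option_eq_iff)
  have det: "det (bordered_matrix A b b d) = k * det A"
    using det_bordered_matrix[OF pos_def_matrix_invertible[OF A]] k(1) by simp
  define q where "q = (x - \<mu>) \<bullet> (matrix_inv A *v (x - \<mu>))"
  define e where "e = t - (m + b \<bullet> (matrix_inv A *v (x - \<mu>)))"
  have "mvn_density (vec_snoc \<mu> m) (bordered_matrix A b b d) (vec_snoc x t) =
      exp (- (q + e\<^sup>2 / k) / 2) / sqrt ((2 * pi) ^ CARD('n option) * (k * det A))"
    unfolding mvn_density_def diff det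
    using k by (subst bordered_quadratic_form[OF A k(1)]) (auto simp: q_def e_def algebra_simps)
  also have "\<dots> = (exp (- q / 2) / sqrt ((2 * pi) ^ CARD('n) * det A)) *
      (1 / sqrt (2 * pi * (sqrt k)\<^sup>2) * exp (- e\<^sup>2 / (2 * (sqrt k)\<^sup>2)))"
  proof -
    have "exp (- (q + e\<^sup>2 / k) / 2) = exp (- q / 2) * exp (- e\<^sup>2 / (2 * k))"
      by (simp add: exp_add[symmetric] add_divide_distrib)
    moreover have "sqrt ((2 * pi) ^ CARD('n option) * (k * det A)) =
        sqrt ((2 * pi) ^ CARD('n) * det A) * sqrt (2 * pi * k)"
      unfolding real_sqrt_mult[symmetric] by (simp add: ac_simps)
    ultimately show ?thesis using k(2) by simp
  qed
  finally show ?thesis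
    unfolding mvn_density_def normal_density_def q_def e_def .
qed

lemma nn_integral_mvn_density_bordered:
  fixes A :: "real^'n^'n"
  assumes A: "pos_def_matrix A" and k: "k = d - b \<bullet> (matrix_inv A *v b)" "k > 0"
  shows "(\<integral>\<^sup>+ t. ennreal (mvn_density (vec_snoc \<mu> m) (bordered_matrix A b b d) (vec_snoc x t)) * indicator {0..} t \<partial>lborel) =
    ennreal (mvn_density \<mu> A x * std_normal_cdf ((m + b \<bullet> (matrix_inv A *v (x - \<mu>))) / sqrt k))"
  unfolding mvn_density_bordered[OF A k]
  using k(2) mvn_density_nonneg[OF A]
  by (simp add: ennreal_mult' nn_integral_cmult mult.assoc nn_integral_normal_density_nonneg_halfline)

section \<open>Lebesgue measure on one more coordinate and on orthants\<close>

lemma Basis_vec_real: "(Basis :: (real^'n) set) = range (\<lambda>i. axis i 1)"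
  by (auto simp: Basis_vec_def)

lemma prod_Basis_vec: "(\<Prod>b\<in>(Basis :: (real^'n) set). f b) = (\<Prod>i\<in>UNIV. f (axis i 1))"
  unfolding Basis_vec_real by (subst prod.reindex) (auto simp: inj_on_def axis_eq_axis)

lemma measurable_vec_snoc [measurable]:
  "(\<lambda>(x :: real^'n, t :: real). vec_snoc x t) \<in> lborel \<Otimes>\<^sub>M lborel \<rightarrow>\<^sub>M borel"
proof -
  have "linear (\<lambda>p :: (real^'n) \<times> real. vec_snoc (fst p) (snd p))"
    by (intro linearI) (simp_all add: vec_option_eq_iff)
  then have "(\<lambda>p :: (real^'n) \<times> real. vec_snoc (fst p) (snd p)) \<in> borel_measurable borel"
    by (intro borel_measurable_continuous_onI linear_continuous_on) (simp add: linear_linear)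
  then show ?thesis
    by (simp add: lborel_prod split_beta')
qed

text \<open>
  Lebesgue measure is determined by the volumes of boxes, and the preimage of a box under appending
  a coordinate is a box times an interval. This is what allows Fubini's theorem on vectors indexed
  by an option type.
\<close>
lemma lborel_vec_snoc:
  "(lborel :: (real^('n::finite option)) measure) =
    distr (lborel \<Otimes>\<^sub>M lborel) borel (\<lambda>(x, t). vec_snoc x t)"
proof (rule lborel_eqI)
  fix l u :: "real^('n option)"
  assume le: "\<And>b. b \<in> Basis \<Longrightarrow> l \<bullet> b \<le> u \<bullet> b"
  have le': "l $ i \<le> u $ i" for i
    using le[of "axis i 1"] by (simp add: inner_axis axis_in_Basis_iff)
  let ?l = "\<chi> i. l $ Some i" and ?u = "\<chi> i. u $ Some i"
  let ?f = "\<lambda>(x :: real^'n, t :: real). vec_snoc x t"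
  have pre: "?f -` box l u \<inter> space (lborel \<Otimes>\<^sub>M lborel) = box ?l ?u \<times> {l $ None <..< u $ None}"
    by (auto simp: space_pair_measure mem_box_cart split_option_all)
  have "emeasure (distr (lborel \<Otimes>\<^sub>M lborel) borel ?f) (box l u) =
      emeasure lborel (box ?l ?u) * emeasure lborel {l $ None <..< u $ None}"
    by (subst emeasure_distr) (auto simp: pre lborel.emeasure_pair_measure_Times)
  also have "\<dots> = ennreal (\<Prod>i\<in>UNIV. u $ Some i - l $ Some i) * ennreal (u $ None - l $ None)"
    using le' by (subst emeasure_lborel_box) (auto simp: Basis_vec_real prod_Basis_vec[unfolded Basis_vec_real] inner_axis)
  also have "\<dots> = ennreal (\<Prod>b\<in>Basis. (u - l) \<bullet> b)"
    using le' by (simp add: prod_Basis_vec inner_axis prod_UNIV_option mult.commute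
        flip: ennreal_mult ennreal_mult' ennreal_mult'')
  finally show "emeasure (distr (lborel \<Otimes>\<^sub>M lborel) borel ?f) (box l u) = ennreal (\<Prod>b\<in>Basis. (u - l) \<bullet> b)" .
qed simp

lemma nn_integral_vec_snoc:
  fixes f :: "real^('n::finite option) \<Rightarrow> ennreal"
  assumes [measurable]: "f \<in> borel_measurable borel"
  shows "(\<integral>\<^sup>+ y. f y \<partial>lborel) = (\<integral>\<^sup>+ x. \<integral>\<^sup>+ t. f (vec_snoc x t) \<partial>lborel \<partial>lborel)"
proof -
  have "(\<integral>\<^sup>+ y. f y \<partial>lborel) = (\<integral>\<^sup>+ p. f (case p of (x, t) \<Rightarrow> vec_snoc x t) \<partial>(lborel \<Otimes>\<^sub>M lborel))"
    by (subst lborel_vec_snoc) (simp add: nn_integral_distr)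
  also have "\<dots> = (\<integral>\<^sup>+ x. \<integral>\<^sup>+ t. f (vec_snoc x t) \<partial>lborel \<partial>lborel)"
    by (subst lborel.nn_integral_fst[symmetric]) auto
  finally show ?thesis .
qed

lemma finite_sign_vectors: "finite (sign_vectors :: (real^'n) set)"
proof -
  have "finite (vec_lambda ` (UNIV \<rightarrow>\<^sub>E {-1, 1 :: real}) :: (real^'n) set)"
    by (intro finite_imageI finite_PiE) auto
  moreover have "sign_vectors \<subseteq> (vec_lambda ` (UNIV \<rightarrow>\<^sub>E {-1, 1 :: real}) :: (real^'n) set)"
  proof
    fix s :: "real^'n" assume "s \<in> sign_vectors"
    then show "s \<in> vec_lambda ` (UNIV \<rightarrow>\<^sub>E {-1, 1 :: real})"
      by (intro image_eqI[of _ _ "vec_nth s"]) (auto simp: sign_vectors_def PiE_def)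
  qed
  ultimately show ?thesis by (rule finite_subset[rotated])
qed

lemma borel_measurable_matrix_vector_mult [measurable]: "(\<lambda>x. A *v x) \<in> borel_measurable borel"
  for A :: "real^'n^'m"
  by (intro borel_measurable_continuous_onI linear_continuous_on matrix_vector_mul_bounded_linear)

lemma distr_lborel_diag_sign:
  fixes s :: "real^'n"
  assumes s: "s \<in> sign_vectors"
  shows "distr lborel borel (\<lambda>x. diag_matrix s *v x) = lborel"
proof -
  have sb: "\<bar>s \<bullet> b\<bar> = 1" if b: "b \<in> Basis" for b
  proof -
    obtain i where i: "b = axis i 1" using b unfolding Basis_vec_real by auto
    have "s $ i = -1 \<or> s $ i = 1" using s unfolding sign_vectors_def by auto
    then show ?thesis unfolding i by (auto simp: inner_axis)
  qed
  have T: "diag_matrix s *v x = 0 + (\<Sum>b\<in>Basis. ((s \<bullet> b) * (x \<bullet> b)) *\<^sub>R b)" for x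
  proof -
    have "(diag_matrix s *v x) \<bullet> b = (s \<bullet> b) * (x \<bullet> b)" if "b \<in> Basis" for b
      using that unfolding Basis_vec_real by (auto simp: inner_axis diag_matrix_mult_vec)
    then show ?thesis
      by - (rule euclidean_eqI, simp add: inner_sum_left_Basis)
  qed
  have "lborel = density (distr lborel borel (\<lambda>x. diag_matrix s *v x)) (\<lambda>_. (\<Prod>b\<in>Basis. \<bar>s \<bullet> b\<bar>))"
    unfolding T by (rule lborel_affine_euclidean) (metis sb abs_zero zero_neq_one)
  also have "(\<lambda>_. ennreal (\<Prod>b\<in>Basis. \<bar>s \<bullet> b\<bar>)) = (\<lambda>_. 1)"
    using sb by simp
  finally show ?thesis by (simp only: density_1)
qed

lemma ex1_sign_vector:
  fixes x :: "real^'n"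
  assumes "\<forall>i. x $ i \<noteq> 0"
  shows "\<exists>!s. s \<in> sign_vectors \<and> 0 \<le> diag_matrix s *v x"
proof (rule ex1I)
  show "(\<chi> i. sgn (x $ i)) \<in> sign_vectors \<and> 0 \<le> diag_matrix (\<chi> i. sgn (x $ i)) *v x"
    using assms by (auto simp: sign_vectors_def less_eq_vec_def diag_matrix_mult_vec sgn_if)
  fix s :: "real^'n" assume s: "s \<in> sign_vectors \<and> 0 \<le> diag_matrix s *v x"
  have "s $ i = sgn (x $ i)" for i
  proof -
    have "s $ i = -1 \<or> s $ i = 1" "0 \<le> s $ i * x $ i" "x $ i \<noteq> 0"
      using s assms by (auto simp: sign_vectors_def less_eq_vec_def diag_matrix_mult_vec)
    then show ?thesis by (auto simp: sgn_if)
  qed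
  then show "s = (\<chi> i. sgn (x $ i))" by (simp add: vec_eq_iff)
qed

lemma borel_nonneg_orthant [measurable]: "{0 :: real^'n ..} \<in> sets borel"
  by (rule borel_closed) (rule closed_eucl_atLeast)

text \<open>
  Each summand is, by reflection, the integral of \<open>g\<close> over one orthant. The orthants overlap only in the
  coordinate hyperplanes, so almost everywhere their indicators sum to one.
\<close>
lemma nn_integral_orthants:
  fixes g :: "real^'n \<Rightarrow> ennreal"
  assumes [measurable]: "g \<in> borel_measurable borel"
  shows "(\<integral>\<^sup>+ x. g x \<partial>lborel) =
    (\<Sum>s\<in>sign_vectors. \<integral>\<^sup>+ x. g (diag_matrix s *v x) * indicator {0..} x \<partial>lborel)"
proof -
  have "(\<integral>\<^sup>+ x. g (diag_matrix s *v x) * indicator {0..} x \<partial>lborel) =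
      (\<integral>\<^sup>+ x. g x * indicator {0..} (diag_matrix s *v x) \<partial>lborel)" if s: "s \<in> sign_vectors" for s :: "real^'n"
  proof -
    have "(\<integral>\<^sup>+ x. g x * indicator {0..} (diag_matrix s *v x) \<partial>lborel) =
        (\<integral>\<^sup>+ x. g x * indicator {0..} (diag_matrix s *v x) \<partial>distr lborel borel (\<lambda>x. diag_matrix s *v x))"
      by (simp only: distr_lborel_diag_sign[OF s])
    also have "\<dots> = (\<integral>\<^sup>+ x. g (diag_matrix s *v x) * indicator {0..} x \<partial>lborel)"
      by (subst nn_integral_distr) (auto simp: diag_sign_involution[OF s])
    finally show ?thesis by (rule sym)
  qed
  then have "(\<Sum>s\<in>sign_vectors. \<integral>\<^sup>+ x. g (diag_matrix s *v x) * indicator {0..} x \<partial>lborel) =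
      (\<Sum>s\<in>sign_vectors. \<integral>\<^sup>+ x. g x * indicator {0..} (diag_matrix s *v x) \<partial>lborel)"
    by (intro sum.cong refl)
  also have "\<dots> = (\<integral>\<^sup>+ x. (\<Sum>s\<in>sign_vectors. g x * indicator {0..} (diag_matrix s *v x)) \<partial>lborel)"
    by (rule nn_integral_sum[symmetric]) measurable
  also have "\<dots> = (\<integral>\<^sup>+ x. g x \<partial>lborel)"
  proof (rule nn_integral_cong_AE)
    have "AE x :: real^'n in lborel. \<forall>i. x $ i \<noteq> 0"
    proof (subst AE_all_countable, rule allI)
      fix i
      show "AE x :: real^'n in lborel. x $ i \<noteq> 0"
        unfolding cart_eq_inner_axis by (rule AE_lborel_inner_neq) (simp add: Basis_vec_real)
    qed
    then show "AE x in lborel. (\<Sum>s\<in>sign_vectors. g x * indicator {0..} (diag_matrix s *v x)) = g x"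
    proof eventually_elim
      fix x :: "real^'n" assume "\<forall>i. x $ i \<noteq> 0"
      then have "\<exists>!s. s \<in> sign_vectors \<and> 0 \<le> diag_matrix s *v x"
        by (rule ex1_sign_vector)
      then obtain s where s: "s \<in> sign_vectors \<and> 0 \<le> diag_matrix s *v x"
        and uniq: "\<forall>s'. s' \<in> sign_vectors \<and> 0 \<le> diag_matrix s' *v x \<longrightarrow> s' = s"
        by (elim ex1E) (rule that)
      have "0 \<le> diag_matrix s' *v x \<longleftrightarrow> s' = s" if "s' \<in> sign_vectors" for s'
        using uniq s that by metis
      then have "(\<Sum>s'\<in>sign_vectors. g x * indicator {0..} (diag_matrix s' *v x)) =
          (\<Sum>s'\<in>sign_vectors. if s' = s then g x else 0)"
        by (intro sum.cong refl) (simp add: indicator_def)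
      then show "(\<Sum>s\<in>sign_vectors. g x * indicator {0..} (diag_matrix s *v x)) = g x"
        using s by (simp add: finite_sign_vectors)
    qed
  qed
  finally show ?thesis by (rule sym)
qed

section \<open>Finiteness of absolute moments\<close>

lemma add_power_le_sum_powers: "(a + b) ^ k \<le> 2 ^ k * (a ^ k + b ^ k)"
  if "0 \<le> a" "0 \<le> b" for a b :: real
proof -
  have "(a + b) ^ k \<le> (2 * max a b) ^ k"
    using that by (intro power_mono) auto
  also have "\<dots> = 2 ^ k * (max a b) ^ k" by (simp add: power_mult_distrib)
  also have "(max a b) ^ k \<le> a ^ k + b ^ k"
    using that by (auto simp: max_def)
  finally show ?thesis by simp
qed

lemma nn_integral_abs_power_gaussian_finite:
  fixes a m :: real
  assumes a: "a > 0"
  shows "(\<integral>\<^sup>+ t. ennreal (\<bar>t\<bar> ^ k * exp (- a * (t - m)\<^sup>2 / 2)) \<partial>lborel) < \<infinity>"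
proof -
  define \<sigma> where "\<sigma> = 1 / sqrt a"
  have \<sigma>: "\<sigma> > 0" "\<sigma>\<^sup>2 = 1 / a" unfolding \<sigma>_def using a by (auto simp: power_divide)
  \<comment> \<open>The power of two comes from bounding \<open>\<bar>t\<bar> ^ k\<close> by powers of \<open>\<bar>t - m\<bar>\<close> and \<open>\<bar>m\<bar>\<close>, the root from the
    normalisation of the normal density.\<close>
  define C where "C = 2 ^ k * sqrt (2 * pi * \<sigma>\<^sup>2)"
  let ?h = "\<lambda>t. C * (normal_density m \<sigma> t * \<bar>t - m\<bar> ^ k + \<bar>m\<bar> ^ k * (normal_density m \<sigma> t * \<bar>t - m\<bar> ^ 0))"
  have int: "integrable lborel ?h"
    by (intro integrable_mult_right Bochner_Integration.integrable_add integrable_normal_moment_abs \<sigma>(1))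
  have "(\<integral>\<^sup>+ t. ennreal (\<bar>t\<bar> ^ k * exp (- a * (t - m)\<^sup>2 / 2)) \<partial>lborel) \<le> (\<integral>\<^sup>+ t. ennreal (norm (?h t)) \<partial>lborel)"
  proof (intro nn_integral_mono ennreal_leI)
    fix t
    have e: "exp (- a * (t - m)\<^sup>2 / 2) = sqrt (2 * pi * \<sigma>\<^sup>2) * normal_density m \<sigma> t"
      using \<sigma> a by (simp add: normal_density_def)
    have "\<bar>t\<bar> ^ k \<le> (\<bar>t - m\<bar> + \<bar>m\<bar>) ^ k" by (intro power_mono) auto
    also have "\<dots> \<le> 2 ^ k * (\<bar>t - m\<bar> ^ k + \<bar>m\<bar> ^ k)" by (rule add_power_le_sum_powers) auto
    finally have "\<bar>t\<bar> ^ k * exp (- a * (t - m)\<^sup>2 / 2) \<le> 2 ^ k * (\<bar>t - m\<bar> ^ k + \<bar>m\<bar> ^ k) * exp (- a * (t - m)\<^sup>2 / 2)"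
      by (rule mult_right_mono) simp
    also have "\<dots> = ?h t" unfolding e C_def by (simp add: algebra_simps)
    finally show "\<bar>t\<bar> ^ k * exp (- a * (t - m)\<^sup>2 / 2) \<le> norm (?h t)" by simp
  qed
  also have "\<dots> < \<infinity>" using int unfolding integrable_iff_bounded by blast
  finally show ?thesis .
qed

lemma borel_measurable_mvn_density [measurable]: "mvn_density \<mu> A \<in> borel_measurable borel"
  for A :: "real^'n^'n"
  unfolding mvn_density_def[abs_def] by measurable

text \<open>
  Coercivity of the inverse covariance bounds the density by a multiple of a product of
  one-dimensional Gaussian functions, and the integral of a product factorises.
\<close>
lemma nn_integral_mvn_abs_moment_finite:
  fixes A :: "real^'n^'n"
  assumes A: "pos_def_matrix A"
  shows "(\<integral>\<^sup>+ x. ennreal (vec_power \<bar>x\<bar> k * mvn_density \<mu> A x) \<partial>lborel) < \<infinity>"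
proof -
  obtain a where a: "a > 0" "\<And>x. a * (norm x)\<^sup>2 \<le> x \<bullet> (matrix_inv A *v x)"
    using pos_def_matrix_coercive[OF pos_def_matrix_inv[OF A]] by blast
  define C where "C = 1 / sqrt ((2 * pi) ^ CARD('n) * det A)"
  have C: "C \<ge> 0" unfolding C_def using pos_def_matrix_det_pos[OF A] by simp
  let ?f = "\<lambda>b t. ennreal (\<bar>t\<bar> ^ (k $ axis_index b) * exp (- a * (t - \<mu> \<bullet> b)\<^sup>2 / 2))"
  have "(\<integral>\<^sup>+ x. ennreal (vec_power \<bar>x\<bar> k * mvn_density \<mu> A x) \<partial>lborel) \<le>
      (\<integral>\<^sup>+ x. ennreal C * (\<Prod>b\<in>Basis. ?f b (x \<bullet> b)) \<partial>lborel)"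
  proof (rule nn_integral_mono)
    fix x
    have "mvn_density \<mu> A x \<le> C * exp (- (a * (norm (x - \<mu>))\<^sup>2) / 2)"
      unfolding mvn_density_def C_def using a(2)[of "x - \<mu>"] pos_def_matrix_det_pos[OF A]
      by (simp add: divide_right_mono)
    also have "exp (- (a * (norm (x - \<mu>))\<^sup>2) / 2) = (\<Prod>i\<in>UNIV. exp (- a * (x $ i - \<mu> $ i)\<^sup>2 / 2))"
    proof -
      have "(norm (x - \<mu>))\<^sup>2 = (\<Sum>i\<in>UNIV. (x $ i - \<mu> $ i)\<^sup>2)"
        unfolding power2_norm_eq_inner by (simp add: inner_vec_def power2_eq_square)
      then show ?thesis
        by (simp add: sum_distrib_left sum_divide_distrib sum_negf flip: exp_sum)
    qed
    finally have "vec_power \<bar>x\<bar> k * mvn_density \<mu> A x \<le>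
        vec_power \<bar>x\<bar> k * (C * (\<Prod>i\<in>UNIV. exp (- a * (x $ i - \<mu> $ i)\<^sup>2 / 2)))"
      by (rule mult_left_mono) (auto simp: vec_power_def abs_vec_def intro!: prod_nonneg)
    also have "\<dots> = C * (\<Prod>i\<in>UNIV. \<bar>x $ i\<bar> ^ (k $ i) * exp (- a * (x $ i - \<mu> $ i)\<^sup>2 / 2))"
      by (simp add: vec_power_def abs_vec_def prod.distrib)
    finally have le: "vec_power \<bar>x\<bar> k * mvn_density \<mu> A x \<le>
        C * (\<Prod>i\<in>UNIV. \<bar>x $ i\<bar> ^ (k $ i) * exp (- a * (x $ i - \<mu> $ i)\<^sup>2 / 2))" .
    have "(\<Prod>b\<in>Basis. ?f b (x \<bullet> b)) =
        ennreal (\<Prod>i\<in>UNIV. \<bar>x $ i\<bar> ^ (k $ i) * exp (- a * (x $ i - \<mu> $ i)\<^sup>2 / 2))"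
      by (simp add: prod_Basis_vec inner_axis prod_ennreal)
    then show "ennreal (vec_power \<bar>x\<bar> k * mvn_density \<mu> A x) \<le> ennreal C * (\<Prod>b\<in>Basis. ?f b (x \<bullet> b))"
      using ennreal_leI[OF le] C by (simp only: ennreal_mult')
  qed
  also have "\<dots> = ennreal C * (\<Prod>b\<in>Basis. \<integral>\<^sup>+ t. ?f b t \<partial>lborel)"
    by (subst nn_integral_cmult, simp, subst nn_integral_lborel_prod) simp_all
  also have "\<dots> < \<infinity>"
  proof -
    have "(\<Prod>b\<in>B. \<integral>\<^sup>+ t. ?f b t \<partial>lborel) < \<infinity>" if "finite B" for B
      using that nn_integral_abs_power_gaussian_finite[OF a(1)]
      by (induction B) (auto simp: ennreal_mult_less_top)
    then show ?thesis by (simp add: ennreal_mult_less_top)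
  qed
  finally show ?thesis .
qed

section \<open>Orthant moments\<close>

lemma borel_measurable_vec_power [measurable]: "(\<lambda>x. vec_power x k) \<in> borel_measurable borel"
  unfolding vec_power_def
  by (intro borel_measurable_continuous_onI continuous_intros)

lemma vec_power_nonneg: "0 \<le> x \<Longrightarrow> 0 \<le> vec_power x k"
  for x :: "real^'n"
  unfolding vec_power_def less_eq_vec_def by (intro prod_nonneg) auto

lemma vec_power_snoc_zero: "vec_power (vec_snoc x t) (vec_snoc k 0) = vec_power x k"
  unfolding vec_power_def by (simp add: prod_UNIV_option)

lemma vec_snoc_nonneg_iff: "0 \<le> vec_snoc x t \<longleftrightarrow> 0 \<le> x \<and> (0::real) \<le> t"
  for x :: "real^'n"
  by (auto simp: less_eq_vec_def split_option_all)

text \<open>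
  The nonnegative determinant makes the density nonnegative, so that the real integral is the real
  value of the extended one; an infinite integral corresponds to the value 0 on both sides.
\<close>
lemma orthant_moment_eq_nn_integral:
  fixes A :: "real^'n^'n"
  assumes "0 \<le> det A"
  shows "orthant_moment k \<mu> A =
    enn2real (\<integral>\<^sup>+ x. ennreal (vec_power x k * mvn_density \<mu> A x) * indicator {0..} x \<partial>lborel)"
proof -
  have "orthant_moment k \<mu> A =
      enn2real (\<integral>\<^sup>+ x. ennreal (indicator {0..} x *\<^sub>R (vec_power x k * mvn_density \<mu> A x)) \<partial>lborel)"
    unfolding orthant_moment_def set_lebesgue_integral_def
  proof (rule integral_eq_nn_integral)
    show "AE x in lborel. 0 \<le> indicator {0..} x *\<^sub>R (vec_power x k * mvn_density \<mu> A x)"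
      using assms by (intro AE_I2) (auto simp: indicator_def vec_power_nonneg mvn_density_def)
  qed measurable
  also have "(\<lambda>x. ennreal (indicator {0..} x *\<^sub>R (vec_power x k * mvn_density \<mu> A x))) =
      (\<lambda>x. ennreal (vec_power x k * mvn_density \<mu> A x) * indicator {0..} x)"
    by (auto simp: indicator_def)
  finally show ?thesis .
qed

text \<open>
  The exponent of the last coordinate is zero, so only the density depends on that coordinate; by
  Fubini it integrates out to a value of the normal distribution function.
\<close>
lemma nn_integral_orthant_bordered:
  fixes A :: "real^'n^'n"
  assumes A: "pos_def_matrix A" and c: "c = d - b \<bullet> (matrix_inv A *v b)" "c > 0"
  shows "(\<integral>\<^sup>+ y. ennreal (vec_power y (vec_snoc k 0) *
        mvn_density (vec_snoc \<mu> m) (bordered_matrix A b b d) y) * indicator {0..} y \<partial>lborel) =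
    (\<integral>\<^sup>+ x. ennreal (vec_power x k * mvn_density \<mu> A x *
        std_normal_cdf ((m + b \<bullet> (matrix_inv A *v (x - \<mu>))) / sqrt c)) * indicator {0..} x \<partial>lborel)"
proof -
  let ?B = "bordered_matrix A b b d"
  have "(\<integral>\<^sup>+ t. ennreal (vec_power (vec_snoc x t) (vec_snoc k 0) * mvn_density (vec_snoc \<mu> m) ?B (vec_snoc x t)) *
        indicator {0..} (vec_snoc x t) \<partial>lborel) =
      ennreal (vec_power x k * mvn_density \<mu> A x *
        std_normal_cdf ((m + b \<bullet> (matrix_inv A *v (x - \<mu>))) / sqrt c)) * indicator {0..} x" for x
  proof (cases "x \<in> {0..}")
    case True
    then have "0 \<le> vec_power x k" by (simp add: vec_power_nonneg)
    have "(\<integral>\<^sup>+ t. ennreal (vec_power (vec_snoc x t) (vec_snoc k 0) * mvn_density (vec_snoc \<mu> m) ?B (vec_snoc x t)) *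
        indicator {0..} (vec_snoc x t) \<partial>lborel) =
      (\<integral>\<^sup>+ t. ennreal (vec_power x k) * (ennreal (mvn_density (vec_snoc \<mu> m) ?B (vec_snoc x t)) * indicator {0..} t) \<partial>lborel)"
      using True \<open>0 \<le> vec_power x k\<close>
      by (intro nn_integral_cong) (simp add: vec_power_snoc_zero ennreal_mult' indicator_def vec_snoc_nonneg_iff)
    also have "\<dots> = ennreal (vec_power x k) *
        (\<integral>\<^sup>+ t. ennreal (mvn_density (vec_snoc \<mu> m) ?B (vec_snoc x t)) * indicator {0..} t \<partial>lborel)"
      unfolding mvn_density_bordered[OF A c] by (rule nn_integral_cmult) measurable
    finally show ?thesis
      using True \<open>0 \<le> vec_power x k\<close>
      by (simp add: nn_integral_mvn_density_bordered[OF A c] ennreal_mult' mult.assoc)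
  next
    case False
    then show ?thesis by (simp add: vec_snoc_nonneg_iff indicator_def)
  qed
  then show ?thesis
    by (subst nn_integral_vec_snoc) simp_all
qed

section \<open>The extended skew-normal distribution\<close>

text \<open>
  For the symmetric square root \<open>R\<close> of \<open>\<Sigma>\<close> one has \<open>R \<Sigma>\<^sup>-\<^sup>1 = R\<^sup>-\<^sup>1\<close>, and \<open>R\<close> moves across the
  inner product.
\<close>
lemma esn_Delta_inner:
  assumes S: "pos_def_matrix \<Sigma>"
  shows "esn_Delta \<Sigma> l \<bullet> (matrix_inv \<Sigma> *v x) =
    l \<bullet> (matrix_inv (matrix_sqrt \<Sigma>) *v x) / sqrt (1 + l \<bullet> l)"
proof -
  let ?R = "matrix_sqrt \<Sigma>"
  note R = matrix_sqrt_works[OF S]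
  have "?R *v (matrix_inv \<Sigma> *v x) = matrix_inv ?R *v x"
  proof (rule matrix_inv_vec_eqI[symmetric])
    show "invertible ?R" by (rule pos_def_matrix_invertible[OF R(1)])
    show "?R *v (?R *v (matrix_inv \<Sigma> *v x)) = x"
      using matrix_inv_right[OF pos_def_matrix_invertible[OF S]] R(2)
      by (simp add: matrix_vector_mul_assoc matrix_mul_assoc)
  qed
  then show ?thesis
    unfolding esn_Delta_def by (simp add: pos_def_matrix_inner_swap[OF R(1)])
qed

text \<open>
  The root in \<open>\<Delta>\<close> cancels, so that \<open>\<Delta> \<bullet> \<Sigma>\<^sup>-\<^sup>1 \<Delta> = (l \<bullet> l) / (1 + l \<bullet> l)\<close> depends on \<open>l\<close> only.
\<close>
lemma esn_Delta_schur_complement: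
  assumes S: "pos_def_matrix \<Sigma>"
  shows "1 - esn_Delta \<Sigma> l \<bullet> (matrix_inv \<Sigma> *v esn_Delta \<Sigma> l) = 1 / (1 + l \<bullet> l)"
proof -
  note R = matrix_sqrt_works[OF S]
  have pos: "1 + l \<bullet> l > 0" by (simp add: add_pos_nonneg)
  have "matrix_inv (matrix_sqrt \<Sigma>) *v esn_Delta \<Sigma> l = (1 / sqrt (1 + l \<bullet> l)) *\<^sub>R l"
    unfolding esn_Delta_def matrix_vector_mult_scaleR
    by (simp add: matrix_vector_mul_assoc matrix_inv_left[OF pos_def_matrix_invertible[OF R(1)]])
  then have "esn_Delta \<Sigma> l \<bullet> (matrix_inv \<Sigma> *v esn_Delta \<Sigma> l) = (l \<bullet> l) / (1 + l \<bullet> l)"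
    unfolding esn_Delta_inner[OF S] using pos by simp
  then show ?thesis using pos by (simp add: field_simps)
qed

lemma flip_off_diagonal_blocks_bordered:
  "flip_off_diagonal_blocks (bordered_matrix A (- b) (- c) d) = bordered_matrix A b c (d::real)"
  unfolding flip_off_diagonal_blocks_def vec_option_eq_iff by simp

text \<open>
  The Schur complement and the conditional mean are invariant under reflection, so on each orthant
  the argument of the distribution function is the one of the skew-normal density at the reflected
  point.
\<close>
lemma nn_integral_orthant_reflected_esn:
  fixes \<Sigma> :: "real^'n^'n"
  assumes S: "pos_def_matrix \<Sigma>" and s: "s \<in> sign_vectors"
  shows "(\<integral>\<^sup>+ y. ennreal (vec_power y (vec_snoc k 0) *
        mvn_density (vec_snoc (diag_matrix s *v \<mu>) (esn_tau l \<tau>))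
          (bordered_matrix (diag_matrix s ** \<Sigma> ** diag_matrix s)
            (diag_matrix s *v esn_Delta \<Sigma> l) (diag_matrix s *v esn_Delta \<Sigma> l) 1) y) *
        indicator {0..} y \<partial>lborel) =
    (\<integral>\<^sup>+ x. ennreal (vec_power x k * mvn_density \<mu> \<Sigma> (diag_matrix s *v x) *
        std_normal_cdf (\<tau> + l \<bullet> (matrix_inv (matrix_sqrt \<Sigma>) *v (diag_matrix s *v x - \<mu>)))) *
        indicator {0..} x \<partial>lborel)"
proof -
  let ?L = "diag_matrix s" and ?D = "esn_Delta \<Sigma> l"
  let ?c = "1 / (1 + l \<bullet> l)"
  have pos: "1 + l \<bullet> l > 0" by (simp add: add_pos_nonneg)
  have c: "?c = 1 - (?L *v ?D) \<bullet> (matrix_inv (?L ** \<Sigma> ** ?L) *v (?L *v ?D))" "?c > 0"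
    using pos esn_Delta_schur_complement[OF S, of l]
    by (simp_all add: matrix_inv_reflected[OF S s] diag_sign_isometry[OF s])
  have dens: "mvn_density (?L *v \<mu>) (?L ** \<Sigma> ** ?L) x = mvn_density \<mu> \<Sigma> (?L *v x)" for x
    using mvn_density_reflected[OF S s, of \<mu> "?L *v x"] by (simp add: diag_sign_involution[OF s])
  have arg: "(esn_tau l \<tau> + (?L *v ?D) \<bullet> (matrix_inv (?L ** \<Sigma> ** ?L) *v (x - ?L *v \<mu>))) / sqrt ?c =
      \<tau> + l \<bullet> (matrix_inv (matrix_sqrt \<Sigma>) *v (?L *v x - \<mu>))" for x
  proof -
    have "x - ?L *v \<mu> = ?L *v (?L *v x - \<mu>)"
      by (simp add: matrix_vector_mult_diff_distrib diag_sign_involution[OF s])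
    then have "(?L *v ?D) \<bullet> (matrix_inv (?L ** \<Sigma> ** ?L) *v (x - ?L *v \<mu>)) =
        l \<bullet> (matrix_inv (matrix_sqrt \<Sigma>) *v (?L *v x - \<mu>)) / sqrt (1 + l \<bullet> l)"
      by (simp only: matrix_inv_reflected[OF S s] diag_sign_isometry[OF s] esn_Delta_inner[OF S])
    then show ?thesis
      using pos unfolding esn_tau_def by (simp add: real_sqrt_divide flip: add_divide_distrib)
  qed
  show ?thesis
    unfolding nn_integral_orthant_bordered[OF pos_def_matrix_reflected[OF S s] c] dens arg ..
qed

lemma vec_power_abs_reflected:
  assumes s: "s \<in> sign_vectors" and x: "0 \<le> x"
  shows "vec_power \<bar>diag_matrix s *v x\<bar> k = vec_power x k"
proof -
  have "\<bar>s $ i * x $ i\<bar> = x $ i" for i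
  proof -
    have "\<bar>s $ i\<bar> = 1" using s by (auto simp: sign_vectors_def dest: spec[of _ i])
    moreover have "0 \<le> x $ i" using x by (simp add: less_eq_vec_def)
    ultimately show ?thesis by (simp add: abs_mult)
  qed
  then show ?thesis by (simp add: vec_power_def abs_vec_def diag_matrix_mult_vec)
qed

lemma borel_measurable_abs_vec [measurable]: "(\<lambda>x :: real^'n. \<bar>x\<bar>) \<in> borel_measurable borel"
  unfolding abs_vec_def by (intro borel_measurable_continuous_onI continuous_intros)

theorem proposition7:
  fixes M :: "'a measure"
    and X Y :: "'a \<Rightarrow> real^'n"
    and \<mu> l :: "real^'n"
    and \<Sigma> :: "real^'n^'n"
    and \<tau> :: real
    and \<kappa> :: "nat^'n"
  assumes "prob_space M"
    and "pos_def_matrix \<Sigma>"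
    and "ESN_distributed M X \<mu> \<Sigma> l \<tau>"
    and "Y = (\<lambda>\<omega>. \<bar>X \<omega>\<bar>)"
  shows "integrable M (\<lambda>\<omega>. vec_power (Y \<omega>) \<kappa>) \<and>
    (LINT \<omega>|M. vec_power (Y \<omega>) \<kappa>) =
      inverse (esn_xi l \<tau>) *
      (\<Sum>s\<in>sign_vectors.
        let \<Lambda>\<^sub>s = diag_matrix s;
            \<mu>\<^sub>s = \<Lambda>\<^sub>s *v \<mu>;
            \<Sigma>\<^sub>s = \<Lambda>\<^sub>s ** \<Sigma> ** \<Lambda>\<^sub>s;
            \<Delta>\<^sub>s = \<Lambda>\<^sub>s *v esn_Delta \<Sigma> l;
            \<Omega>\<^sub>s = bordered_matrix \<Sigma>\<^sub>s (- \<Delta>\<^sub>s) (- \<Delta>\<^sub>s) 1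
        in orthant_moment (vec_snoc \<kappa> 0) (vec_snoc \<mu>\<^sub>s (esn_tau l \<tau>))
             (flip_off_diagonal_blocks \<Omega>\<^sub>s))"
proof -
  note S = assms(2)
  define \<xi> where "\<xi> = esn_xi l \<tau>"
  have xi: "0 \<le> inverse \<xi>"
    unfolding \<xi>_def esn_xi_def by (simp add: std_normal_cdf_nonneg)
  define h where "h x = mvn_density \<mu> \<Sigma> x *
      std_normal_cdf (\<tau> + l \<bullet> (matrix_inv (matrix_sqrt \<Sigma>) *v (x - \<mu>)))" for x
  have h_meas [measurable]: "h \<in> borel_measurable borel"
    unfolding h_def[abs_def] by measurable
  have h: "0 \<le> h x" "h x \<le> mvn_density \<mu> \<Sigma> x" for x
    unfolding h_def using mvn_density_nonneg[OF S, of \<mu> x] std_normal_cdf_nonneg std_normal_cdf_le_1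
    by (simp_all add: mult_left_le)
  have pow: "0 \<le> vec_power \<bar>x\<bar> \<kappa>" for x :: "real^'n"
    by (rule vec_power_nonneg) (simp add: less_eq_vec_def abs_vec_def)
  have dist: "distributed M lborel X (\<lambda>x. ennreal (inverse \<xi> * h x))"
    using assms(3) unfolding ESN_distributed_def esn_density_def h_def \<xi>_def by (simp add: mult.assoc)
  define J where "J s = (\<integral>\<^sup>+ x. ennreal (vec_power x \<kappa> * h (diag_matrix s *v x)) * indicator {0..} x \<partial>lborel)" for s
  define T where "T = (\<integral>\<^sup>+ x. ennreal (vec_power \<bar>x\<bar> \<kappa> * h x) \<partial>lborel)"
  \<comment> \<open>The skewing factor is at most one, so the normal moments dominate.\<close>
  have T_fin: "T < \<infinity>"
  proof -
    have "T \<le> (\<integral>\<^sup>+ x. ennreal (vec_power \<bar>x\<bar> \<kappa> * mvn_density \<mu> \<Sigma> x) \<partial>lborel)"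
      unfolding T_def by (intro nn_integral_mono ennreal_leI mult_left_mono h(2) pow)
    then show ?thesis using nn_integral_mvn_abs_moment_finite[OF S] by (rule le_less_trans)
  qed
  have T_sum: "T = (\<Sum>s\<in>sign_vectors. J s)"
    unfolding T_def J_def
    by (subst nn_integral_orthants, measurable)
       (intro sum.cong nn_integral_cong refl, auto simp: indicator_def vec_power_abs_reflected)
  have J_fin: "J s < \<infinity>" if "s \<in> sign_vectors" for s
  proof -
    have "J s \<le> T"
      unfolding T_sum by (rule member_le_sum[OF that]) (simp_all add: finite_sign_vectors)
    then show ?thesis using T_fin by (rule le_less_trans)
  qed
  have expect: "(\<integral>\<^sup>+ \<omega>. ennreal (vec_power (Y \<omega>) \<kappa>) \<partial>M) = ennreal (inverse \<xi>) * T"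
  proof -
    have "(\<integral>\<^sup>+ \<omega>. ennreal (vec_power (Y \<omega>) \<kappa>) \<partial>M) =
        (\<integral>\<^sup>+ x. ennreal (inverse \<xi> * h x) * ennreal (vec_power \<bar>x\<bar> \<kappa>) \<partial>lborel)"
      unfolding assms(4) by (rule distributed_nn_integral[OF dist, symmetric]) measurable
    also have "\<dots> = (\<integral>\<^sup>+ x. ennreal (inverse \<xi>) * ennreal (vec_power \<bar>x\<bar> \<kappa> * h x) \<partial>lborel)"
      using xi h(1) pow by (intro nn_integral_cong) (simp add: mult.commute flip: ennreal_mult)
    also have "\<dots> = ennreal (inverse \<xi>) * T"
      unfolding T_def by (rule nn_integral_cmult) measurable
    finally show ?thesis .
  qed
  have [measurable]: "X \<in> borel_measurable M"
    using distributed_measurable[OF dist] by simp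
  have meas: "(\<lambda>\<omega>. vec_power (Y \<omega>) \<kappa>) \<in> borel_measurable M"
    unfolding assms(4) by measurable
  have Y_nonneg: "0 \<le> vec_power (Y \<omega>) \<kappa>" for \<omega>
    unfolding assms(4) by (rule pow)
  have "integrable M (\<lambda>\<omega>. vec_power (Y \<omega>) \<kappa>)"
  proof (rule integrableI_nonneg[OF meas])
    show "(\<integral>\<^sup>+ \<omega>. ennreal (vec_power (Y \<omega>) \<kappa>) \<partial>M) < \<infinity>"
      unfolding expect using T_fin by (simp add: ennreal_mult_less_top)
  qed (simp add: Y_nonneg)
  moreover have "(LINT \<omega>|M. vec_power (Y \<omega>) \<kappa>) = inverse \<xi> * enn2real T"
    using xi
    by (subst integral_eq_nn_integral[OF meas]) (simp_all add: Y_nonneg expect enn2real_mult)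
  moreover have "enn2real T = (\<Sum>s\<in>sign_vectors. enn2real (J s))"
    unfolding T_sum by (subst enn2real_sum) (use J_fin in auto)
  moreover have "enn2real (J s) =
      orthant_moment (vec_snoc \<kappa> 0) (vec_snoc (diag_matrix s *v \<mu>) (esn_tau l \<tau>))
        (bordered_matrix (diag_matrix s ** \<Sigma> ** diag_matrix s)
          (diag_matrix s *v esn_Delta \<Sigma> l) (diag_matrix s *v esn_Delta \<Sigma> l) 1)"
    if s: "s \<in> sign_vectors" for s
  proof -
    let ?L = "diag_matrix s" and ?D = "esn_Delta \<Sigma> l"
    have "0 \<le> det (bordered_matrix (?L ** \<Sigma> ** ?L) (?L *v ?D) (?L *v ?D) 1)"
      using pos_def_matrix_det_pos[OF pos_def_matrix_reflected[OF S s]] esn_Delta_schur_complement[OF S, of l]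
      by (subst det_bordered_matrix[OF pos_def_matrix_invertible[OF pos_def_matrix_reflected[OF S s]]])
         (simp add: matrix_inv_reflected[OF S s] diag_sign_isometry[OF s] add_nonneg_nonneg)
    then show ?thesis
      unfolding J_def h_def
      by (simp only: orthant_moment_eq_nn_integral nn_integral_orthant_reflected_esn[OF S s] mult.assoc)
  qed
  ultimately show ?thesis
    by (simp add: Let_def flip_off_diagonal_blocks_bordered \<xi>_def)
qed

end
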